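(* Let $f_0,F:\mathbb{R}^n\times\mathbb{R}^d\to\mathbb{R}$ be twice continuously differentiable functions. For $w\in\mathbb{R}^d$ put $C(w)=\{x\in\mathbb{R}^n\mid F(x,w)\le 0\}$ and $$S(w)=\{x\in\mathbb{R}^n\mid 0\in\nabla_xf_0(x,w)+N_{C(w)}(x)\}.$$ Let $\bar w\in\mathbb{R}^d$ and $\bar x\in S(\bar w)$, and suppose that $F(\bar x,\bar w)<0$. Consider the two conditions $$(\mathrm{A})\quad \ker\nabla^2_{xx}f_0(\bar x,\bar w)\cap\ker\nabla^2_{wx}f_0(\bar x,\bar w)=\{0\},$$ $$(\mathrm{B})\quad \ker\nabla^2_{xx}f_0(\bar x,\bar w)\subset\ker\nabla^2_{wx}f_0(\bar x,\bar w).$$ Then the following assertions are valid: (a) If $S$ is locally Lipschitz-like around $(\bar w,\bar x)$, then (B) holds. (b) If (A) and (B) are simultaneously fulfilled, then $S$ is locally Lipschitz-like around $(\bar w,\bar x)$. (c) If (A) is satisfied, then $S$ is locally Lipschitz-like around $(\bar w,\bar x)$ if and only if (B) holds.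
   Context: Fréchet normal cone: for $\Omega\subset\mathbb{R}^s$ and $\bar v\in\Omega$, $\widehat N_\Omega(\bar v)=\{v'\in\mathbb{R}^s\mid \limsup_{v\to\bar v,\,v\in\Omega}\frac{\langle v',v-\bar v\rangle}{\|v-\bar v\|}\le 0\}$, and $\widehat N_\Omega(\bar v)=\emptyset$ if $\bar v\notin\Omega$. Mordukhovich (limiting) normal cone, for $\Omega$ locally closed around $\bar v\in\Omega$: $N_\Omega(\bar v)$ is the set of all $v'$ for which there are sequences $v_k\to\bar v$, $v'_k\to v'$ with $v'_k\in\widehat N_\Omega(v_k)$ for all $k$; $N_\Omega(\bar v)=\emptyset$ if $\bar v\notin\Omega$. The map $S:\mathbb{R}^d\rightrightarrows\mathbb{R}^n$ is the stationary point set map of the parametric problem of minimizing $f_0(x,w)$ subject to $F(x,w)\le 0$. $\nabla^2_{xx}f_0(\bar x,\bar w)$ is the $n\times n$ Hessian matrix in $x$, and $\nabla^2_{wx}f_0(\bar x,\bar w)$ is the $d\times n$ matrix with entries $\partial^2f_0/\partial w_i\partial x_j$ at $(\bar x,\bar w)$; both act on vectors of $\mathbb{R}^n$. A multifunction $S:\mathbb{R}^d\rightrightarrows\mathbb{R}^n$ is locally Lipschitz-like around $(\bar w,\bar x)\in\mathrm{gph}\,S=\{(w,x)\mid x\in S(w)\}$ if there exist $\ell>0$ and neighborhoods $U$ of $\bar x$ and $V$ of $\bar w$ such that $S(w')\cap U\subset S(w)+\ell\|w'-w\|\bar B$ for all $w,w'\in V$, where $\bar B$ is the closed unit ball of $\mathbb{R}^n$.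 *)

theory Defs
  imports "HOL-Analysis.Analysis"
begin

definition twice_continuously_differentiable :: "('a::euclidean_space \<Rightarrow> real) \<Rightarrow> bool" where
  "twice_continuously_differentiable f \<longleftrightarrow>
     (\<exists>(f' :: 'a \<Rightarrow> 'a \<Rightarrow>\<^sub>L real) (f'' :: 'a \<Rightarrow> 'a \<Rightarrow>\<^sub>L ('a \<Rightarrow>\<^sub>L real)).
        (\<forall>z. (f has_derivative blinfun_apply (f' z)) (at z)) \<and>
        (\<forall>z. (f' has_derivative blinfun_apply (f'' z)) (at z)) \<and>
        continuous_on UNIV f'')"

definition partial_x :: "'n::finite \<Rightarrow> ((real^'n) \<times> (real^'d::finite) \<Rightarrow> real) \<Rightarrow> (real^'n) \<times> (real^'d) \<Rightarrow> real" where
  "partial_x j f z = deriv (\<lambda>t. f (z + t *\<^sub>R (axis j 1, 0))) 0"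

definition partial_w :: "'d::finite \<Rightarrow> ((real^'n::finite) \<times> (real^'d) \<Rightarrow> real) \<Rightarrow> (real^'n) \<times> (real^'d) \<Rightarrow> real" where
  "partial_w i f z = deriv (\<lambda>t. f (z + t *\<^sub>R (0, axis i 1))) 0"

definition grad_x :: "((real^'n::finite) \<times> (real^'d::finite) \<Rightarrow> real) \<Rightarrow> (real^'n) \<times> (real^'d) \<Rightarrow> real^'n" where
  "grad_x f z = (\<chi> j. partial_x j f z)"

definition hess_xx :: "((real^'n::finite) \<times> (real^'d::finite) \<Rightarrow> real) \<Rightarrow> (real^'n) \<times> (real^'d) \<Rightarrow> real^'n^'n" where
  "hess_xx f z = (\<chi> i j. partial_x i (partial_x j f) z)"

definition hess_wx :: "((real^'n::finite) \<times> (real^'d::finite) \<Rightarrow> real) \<Rightarrow> (real^'n) \<times> (real^'d) \<Rightarrow> real^'n^'d" where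
  "hess_wx f z = (\<chi> i j. partial_w i (partial_x j f) z)"

definition mat_ker :: "real^'n^'m \<Rightarrow> (real^'n) set" where
  "mat_ker A = {v. A *v v = 0}"

(* The Limsup is taken in ereal, so that at an isolated point of \<Omega>, where the filter
   is trivial, it is -\<infinity> and every vector is a normal. *)
definition frechet_normal_cone :: "'a::euclidean_space set \<Rightarrow> 'a \<Rightarrow> 'a set" where
  "frechet_normal_cone \<Omega> v =
     {v'. v \<in> \<Omega> \<and> Limsup (at v within \<Omega>) (\<lambda>u. ereal (inner v' (u - v) / norm (u - v))) \<le> 0}"

(* Meant for sets \<Omega> that are locally closed around v. *)
definition limiting_normal_cone :: "'a::euclidean_space set \<Rightarrow> 'a \<Rightarrow> 'a set" where
  "limiting_normal_cone \<Omega> v =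
     {v'. v \<in> \<Omega> \<and>
        (\<exists>(u :: nat \<Rightarrow> 'a) (u' :: nat \<Rightarrow> 'a). u \<longlonglongrightarrow> v \<and> u' \<longlonglongrightarrow> v' \<and>
           (\<forall>k. u' k \<in> frechet_normal_cone \<Omega> (u k)))}"

definition feasible_set :: "((real^'n::finite) \<times> (real^'d::finite) \<Rightarrow> real) \<Rightarrow> real^'d \<Rightarrow> (real^'n) set" where
  "feasible_set F w = {x. F (x, w) \<le> 0}"

definition stationary_points ::
  "((real^'n::finite) \<times> (real^'d::finite) \<Rightarrow> real) \<Rightarrow> ((real^'n) \<times> (real^'d) \<Rightarrow> real) \<Rightarrow> real^'d \<Rightarrow> (real^'n) set" where
  "stationary_points f F w =
     {x. 0 \<in> (\<lambda>v. grad_x f (x, w) + v) ` limiting_normal_cone (feasible_set F w) x}"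

(* Neighbourhoods are arbitrary sets containing the point in their interior. *)
definition locally_Lipschitz_like ::
  "('b::euclidean_space \<Rightarrow> 'a::euclidean_space set) \<Rightarrow> 'b \<Rightarrow> 'a \<Rightarrow> bool" where
  "locally_Lipschitz_like S wbar xbar \<longleftrightarrow> xbar \<in> S wbar \<and>
     (\<exists>l>0. \<exists>U V. xbar \<in> interior U \<and> wbar \<in> interior V \<and>
        (\<forall>w\<in>V. \<forall>w'\<in>V.
           S w' \<inter> U \<subseteq> {x + (l * norm (w' - w)) *\<^sub>R b | x b. x \<in> S w \<and> b \<in> cball 0 1}))"

end

theory Submission
  imports Defs
begin

text \<open>
  Since \<open>F (xbar, wbar) < 0\<close>, the normal cone is trivial near the reference point, so there
  \<open>S\<close> is the solution map of \<open>grad_x f0 (x, w) = 0\<close>. Let \<open>G\<close> be the derivative of \<open>grad_x f0\<close>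
  at the reference point; then \<open>G (h, k) \<bullet> v = h \<bullet> (hess_xx v) + k \<bullet> (hess_wx v)\<close>.

  If \<open>S\<close> is Lipschitz-like, then for every direction \<open>k\<close> there are solutions at distance \<open>O(t)\<close>
  for the parameters \<open>wbar + t k\<close>; testing the expansion of \<open>grad_x f0\<close> along them against
  \<open>v \<in> ker hess_xx\<close> gives \<open>k \<bullet> (hess_wx v) = 0\<close>. Conversely, (A) and (B) together say that
  \<open>hess_xx\<close> is injective, and solutions are then found as fixed points of the simplified Newton map,
  a contraction uniformly in the parameter. Symmetry of the Hessian plays no role.
\<close>

section \<open>Normal cones at interior points\<close>

text \<open>A nonzero normal \<open>v'\<close> can be tested in its own direction: at
  \<open>v + t *\<^sub>R v'\<close> with \<open>t > 0\<close> the quotient equals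
  \<open>norm v'\<close>, which contradicts a nonpositive Limsup.\<close>

lemma frechet_normal_cone_interior:
  assumes "v \<in> interior \<Omega>"
  shows "frechet_normal_cone \<Omega> v = {0}"
proof -
  have v: "v \<in> \<Omega>" using assms interior_subset by blast
  have "v' = 0" if "v' \<in> frechet_normal_cone \<Omega> v" for v'
  proof (rule ccontr)
    assume nz: "v' \<noteq> 0"
    have "Limsup (at v) (\<lambda>u. ereal (inner v' (u - v) / norm (u - v))) \<le> 0"
      using that unfolding frechet_normal_cone_def at_within_interior[OF assms] by blast
    also have "\<dots> < ereal (norm v')" using nz by simp
    finally have "\<forall>\<^sub>F u in at v. ereal (inner v' (u - v) / norm (u - v)) < ereal (norm v')"
      by (rule Limsup_lessD)
    then obtain d where d: "d > 0"
      and lt: "\<And>u. u \<noteq> v \<Longrightarrow> dist u v < d \<Longrightarrow> inner v' (u - v) / norm (u - v) < norm v'"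
      by (auto simp: eventually_at)
    \<comment> \<open>This makes \<open>norm (t *\<^sub>R v')\<close> equal to
      \<open>d / 2\<close>.\<close>
    define t where "t = d / (2 * norm v')"
    have t: "t > 0" "norm (t *\<^sub>R v') < d" using d nz by (auto simp: t_def)
    then have "inner v' (t *\<^sub>R v') / norm (t *\<^sub>R v') < norm v'"
      using lt[of "v + t *\<^sub>R v'"] nz by (simp add: dist_norm del: norm_scaleR inner_scaleR_right)
    then show False
      using t(1) nz by (simp add: dot_square_norm power2_eq_square)
  qed
  moreover have "0 \<in> frechet_normal_cone \<Omega> v"
    using v unfolding frechet_normal_cone_def
    by (intro CollectI conjI Limsup_bounded) (auto simp: zero_ereal_def)
  ultimately show ?thesis by blast
qed

text \<open>The base points \<open>u k\<close> eventually enter the open interior, where every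
  Frechet normal is 0, so the limit of the normals is 0.\<close>

lemma limiting_normal_cone_interior:
  assumes "v \<in> interior \<Omega>"
  shows "limiting_normal_cone \<Omega> v = {0}"
proof -
  have v: "v \<in> \<Omega>" using assms interior_subset by blast
  have "v' = 0" if "v' \<in> limiting_normal_cone \<Omega> v" for v'
  proof -
    obtain u u' where lim: "u \<longlonglongrightarrow> v" "u' \<longlonglongrightarrow> v'"
      and cone: "\<And>k. u' k \<in> frechet_normal_cone \<Omega> (u k)"
      using \<open>v' \<in> _\<close> unfolding limiting_normal_cone_def by blast
    have "\<forall>\<^sub>F k in sequentially. u k \<in> interior \<Omega>"
      using lim(1) assms by (auto intro: topological_tendstoD)
    then have "\<forall>\<^sub>F k in sequentially. u' k = 0"
      by eventually_elim (use cone frechet_normal_cone_interior in blast)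
    then have "u' \<longlonglongrightarrow> 0" by (rule tendsto_eventually)
    then show "v' = 0" using lim(2) LIMSEQ_unique by blast
  qed
  moreover have "0 \<in> limiting_normal_cone \<Omega> v"
    unfolding limiting_normal_cone_def
    using v by (intro CollectI conjI exI[of _ "\<lambda>_. v"] exI[of _ "\<lambda>_. 0"] allI tendsto_const)
      (simp_all add: frechet_normal_cone_interior[OF assms])
  ultimately show ?thesis by blast
qed

text \<open>A strict inequality persists for nearby \<open>x\<close>, so \<open>x\<close> is
  interior to the feasible set and the normal cone is trivial.\<close>

lemma stationary_points_iff_grad_x_eq_0:
  assumes "continuous_on UNIV F" and "F (x, w) < 0"
  shows "x \<in> stationary_points f F w \<longleftrightarrow> grad_x f (x, w) = 0"
proof -
  have "open {y. F (y, w) < 0}"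
    by (intro open_Collect_less continuous_on_compose2[OF assms(1)] continuous_intros) auto
  then have "{y. F (y, w) < 0} \<subseteq> interior (feasible_set F w)"
    by (intro interior_maximal) (auto simp: feasible_set_def)
  then have "limiting_normal_cone (feasible_set F w) x = {0}"
    using assms(2) by (intro limiting_normal_cone_interior) auto
  then show ?thesis by (auto simp: stationary_points_def)
qed

section \<open>Strict differentiability of the partial gradient\<close>

text \<open>Links the partial derivatives, defined by \<open>deriv\<close> along coordinate lines,
  to the total derivative at axis vectors.\<close>

lemma deriv_along_line:
  assumes "(f has_derivative f') (at z)"
  shows "deriv (\<lambda>t. f (z + t *\<^sub>R h)) 0 = f' h"
proof -
  interpret bounded_linear f' using assms by (rule has_derivative_bounded_linear)
  have "((\<lambda>t. f (z + t *\<^sub>R h)) has_derivative (\<lambda>t. f' (t *\<^sub>R h))) (at 0)"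
    by (rule has_derivative_compose[where f = "\<lambda>t. z + t *\<^sub>R h" and g = f])
       (use assms in \<open>auto intro!: derivative_eq_intros\<close>)
  then have "((\<lambda>t. f (z + t *\<^sub>R h)) has_field_derivative f' h) (at 0)"
    by (simp add: has_field_derivative_def scaleR mult.commute[of _ "f' h"])
  then show ?thesis by (rule DERIV_imp_deriv)
qed

text \<open>Both \<open>x\<close> and \<open>y\<close> vary, unlike in the Frechet derivative, where
  \<open>y = z\<close>. This uniformity is what yields a contraction estimate between arbitrary
  pairs of points.\<close>

definition has_strict_derivative ::
  "('a::real_normed_vector \<Rightarrow> 'b::real_normed_vector) \<Rightarrow> ('a \<Rightarrow> 'b) \<Rightarrow> 'a \<Rightarrow> bool" where
  "has_strict_derivative g G z \<longleftrightarrow> bounded_linear G \<and>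
     (\<forall>e>0. \<exists>R>0. \<forall>x\<in>ball z R. \<forall>y\<in>ball z R. norm (g x - g y - G (x - y)) \<le> e * norm (x - y))"

lemma has_strict_derivativeE:
  assumes "has_strict_derivative g G z" and "e > 0"
  obtains R where "R > 0"
    and "\<And>x y. x \<in> ball z R \<Longrightarrow> y \<in> ball z R \<Longrightarrow> norm (g x - g y - G (x - y)) \<le> e * norm (x - y)"
  using assms unfolding has_strict_derivative_def by metis

text \<open>The mean value inequality on a convex ball applies to \<open>g\<close> minus its
  linearization, whose derivative \<open>g' u - g' z\<close> is small there by continuity.\<close>

lemma has_strict_derivative_C1:
  fixes g' :: "'a::real_normed_vector \<Rightarrow> 'a \<Rightarrow>\<^sub>L 'b::real_normed_vector"
  assumes "\<And>z. (g has_derivative blinfun_apply (g' z)) (at z)" and "continuous_on UNIV g'"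
  shows "has_strict_derivative g (blinfun_apply (g' z)) z"
  unfolding has_strict_derivative_def
proof (intro conjI allI impI)
  show "bounded_linear (blinfun_apply (g' z))" by (rule blinfun.bounded_linear_right)
  fix e :: real assume "e > 0"
  then obtain R where R: "R > 0" "\<And>y. dist y z < R \<Longrightarrow> dist (g' y) (g' z) < e"
    using assms(2) unfolding continuous_on_iff by (metis UNIV_I)
  have "norm (g x - g y - g' z (x - y)) \<le> e * norm (x - y)"
    if "x \<in> ball z R" "y \<in> ball z R" for x y
  proof -
    have "norm (g x - g y - g' z (x - y)) \<le> norm (x - y) * e"
    proof (rule differentiable_bound_linearization[where S = "ball z R"])
      show "y + t *\<^sub>R (x - y) \<in> ball z R" if "t \<in> {0..1}" for t
      proof -
        have "(1 - t) *\<^sub>R y + t *\<^sub>R x \<in> ball z R"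
          using \<open>x \<in> _\<close> \<open>y \<in> _\<close> that by (intro convexD[OF convex_ball]) auto
        then show ?thesis by (simp add: algebra_simps)
      qed
      show "(g has_derivative blinfun_apply (g' u)) (at u within ball z R)" for u
        using assms(1) by (rule has_derivative_at_withinI)
      show "onorm (blinfun_apply (g' u) - blinfun_apply (g' z)) \<le> e" if "u \<in> ball z R" for u
        using R(2)[of u] that
        by (simp add: dist_norm norm_blinfun.rep_eq minus_blinfun.rep_eq norm_minus_commute fun_diff_def)
    qed (use R(1) in simp)
    then show ?thesis by (simp add: mult.commute)
  qed
  with R(1) show "\<exists>R>0. \<forall>x\<in>ball z R. \<forall>y\<in>ball z R. norm (g x - g y - g' z (x - y)) \<le> e * norm (x - y)"
    by blast
qed

lemma has_strict_derivative_bounded_linear: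
  assumes "bounded_linear L" and "has_strict_derivative g G z"
  shows "has_strict_derivative (\<lambda>x. L (g x)) (\<lambda>h. L (G h)) z"
  unfolding has_strict_derivative_def
proof (intro conjI allI impI)
  interpret L: bounded_linear L by fact
  show "bounded_linear (\<lambda>h. L (G h))"
    using assms by (auto simp: has_strict_derivative_def intro: bounded_linear_compose)
  fix e :: real assume "e > 0"
  obtain K where K: "K > 0" "\<And>x. norm (L x) \<le> norm x * K"
    using L.pos_bounded by blast
  obtain R where R: "R > 0" "\<And>x y. x \<in> ball z R \<Longrightarrow> y \<in> ball z R \<Longrightarrow>
      norm (g x - g y - G (x - y)) \<le> e / K * norm (x - y)"
    using has_strict_derivativeE[OF assms(2), of "e / K"] \<open>e > 0\<close> K(1) by auto
  have "norm (L (g x) - L (g y) - L (G (x - y))) \<le> e * norm (x - y)"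
    if "x \<in> ball z R" "y \<in> ball z R" for x y
  proof -
    have "norm (L (g x) - L (g y) - L (G (x - y))) \<le> norm (g x - g y - G (x - y)) * K"
      using K(2)[of "g x - g y - G (x - y)"] by (simp add: L.diff)
    also have "\<dots> \<le> e / K * norm (x - y) * K"
      using R(2)[OF that] K(1) by (intro mult_right_mono) auto
    finally show ?thesis using K(1) by simp
  qed
  with R(1) show "\<exists>R>0. \<forall>x\<in>ball z R. \<forall>y\<in>ball z R.
      norm (L (g x) - L (g y) - L (G (x - y))) \<le> e * norm (x - y)"
    by blast
qed

text \<open>\<open>grad_x f\<close> is a linear image of the total derivative, and \<open>G\<close>
  is the same image of \<open>f'' z\<close>. The first argument of \<open>f'' z\<close> is the outer
  differentiation, hence the row index of the Hessian blocks: \<open>G\<close> acts by their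
  transposes.\<close>

lemma grad_x_strict_derivative:
  fixes f :: "(real^'n::finite) \<times> (real^'d::finite) \<Rightarrow> real"
  assumes "twice_continuously_differentiable f"
  obtains G where "has_strict_derivative (grad_x f) G z"
    and "\<And>h k v. G (h, k) \<bullet> v = h \<bullet> (hess_xx f z *v v) + k \<bullet> (hess_wx f z *v v)"
proof -
  obtain f' f'' where f': "\<And>z. (f has_derivative blinfun_apply (f' z)) (at z)"
    and f'': "\<And>z. (f' has_derivative blinfun_apply (f'' z)) (at z)"
    and cont: "continuous_on UNIV f''"
    using assms unfolding twice_continuously_differentiable_def by blast
  define L :: "(((real^'n) \<times> (real^'d)) \<Rightarrow>\<^sub>L real) \<Rightarrow> real^'n"
    where "L \<phi> = (\<chi> j. \<phi> (axis j 1, 0))" for \<phi>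
  have blL: "bounded_linear L"
    unfolding L_def
    by (rule bounded_linear_componentwise_iff[THEN iffD2])
       (auto simp: Basis_vec_def inner_axis intro: blinfun.bounded_linear_left)
  have px: "partial_x j f = (\<lambda>y. f' y (axis j 1, 0))" for j
    by (rule ext) (simp only: partial_x_def deriv_along_line[OF f'])
  have px': "(partial_x j f has_derivative (\<lambda>h. f'' z h (axis j 1, 0))) (at z)" for j z
    unfolding px by (rule bounded_linear.has_derivative[OF blinfun.bounded_linear_left f''])
  have hxx: "hess_xx f z $ i $ j = f'' z (axis i 1, 0) (axis j 1, 0)" for i j
    by (simp only: hess_xx_def partial_x_def[of i] deriv_along_line[OF px'] vec_lambda_beta)
  have hwx: "hess_wx f z $ i $ j = f'' z (0, axis i 1) (axis j 1, 0)" for i j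
    by (simp only: hess_wx_def partial_w_def[of i] deriv_along_line[OF px'] vec_lambda_beta)
  have "grad_x f = (\<lambda>y. L (f' y))"
    by (simp add: grad_x_def px L_def fun_eq_iff)
  then have "has_strict_derivative (grad_x f) (\<lambda>h. L (f'' z h)) z"
    using has_strict_derivative_bounded_linear[OF blL has_strict_derivative_C1[OF f'' cont]] by simp
  moreover have "L (f'' z (h, k)) \<bullet> v = h \<bullet> (hess_xx f z *v v) + k \<bullet> (hess_wx f z *v v)" for h k v
  proof -
    \<comment> \<open>Expanding along the axes reduces \<open>f'' z\<close> to the Hessian entries
      by linearity.\<close>
    have "(h, k) = (\<Sum>i\<in>UNIV. h $ i *\<^sub>R (axis i 1, 0)) + (\<Sum>i\<in>UNIV. k $ i *\<^sub>R (0, axis i 1))"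
      (is "_ = ?s")
    proof (rule prod_eqI)
      show "fst (h, k) = fst ?s"
        using basis_expansion[of h] by (simp add: fst_sum scalar_mult_eq_scaleR)
      show "snd (h, k) = snd ?s"
        using basis_expansion[of k] by (simp add: snd_sum scalar_mult_eq_scaleR)
    qed
    then have "f'' z (h, k) (axis j 1, 0) =
        (\<Sum>i\<in>UNIV. h $ i * hess_xx f z $ i $ j) + (\<Sum>i\<in>UNIV. k $ i * hess_wx f z $ i $ j)" for j
      by (simp only: hxx hwx real_scaleR_def blinfun.add_right blinfun.sum_right blinfun.scaleR_right
          blinfun.add_left blinfun.sum_left blinfun.scaleR_left)
    then have "L (f'' z (h, k)) \<bullet> v =
        (\<Sum>j\<in>UNIV. \<Sum>i\<in>UNIV. h $ i * hess_xx f z $ i $ j * v $ j) +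
        (\<Sum>j\<in>UNIV. \<Sum>i\<in>UNIV. k $ i * hess_wx f z $ i $ j * v $ j)"
      by (simp add: L_def inner_vec_def distrib_right sum_distrib_right sum.distrib)
    also have "\<dots> = h \<bullet> (hess_xx f z *v v) + k \<bullet> (hess_wx f z *v v)"
      by (rule arg_cong2[where f = "(+)"]; subst sum.swap)
         (simp_all add: inner_vec_def matrix_vector_mult_def sum_distrib_left mult.assoc)
    finally show ?thesis .
  qed
  ultimately show ?thesis using that by blast
qed

section \<open>Lipschitz dependence of solutions on the parameter\<close>

text \<open>With \<open>A\<close> the inverse of \<open>G (\<cdot>, 0)\<close>, the map
  \<open>x - A (g (x, w))\<close> is a 1/2-contraction of \<open>cball x0 r\<close> for each
  \<open>w\<close> near \<open>w0\<close>. A solution for \<open>w'\<close> is almost fixed by the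
  map for \<open>w\<close>, hence close to its fixed point. The bound \<open>\<rho>\<close> lets the
  radii be confined to a prescribed region.\<close>

lemma Lipschitz_implicit_solutions:
  fixes g :: "'a::euclidean_space \<times> 'b::real_normed_vector \<Rightarrow> 'a"
  assumes strict: "has_strict_derivative g G (x0, w0)" and inj: "inj (\<lambda>h. G (h, 0))"
    and zero: "g (x0, w0) = 0" and "\<rho> > 0"
  obtains r s l where "0 < r" "r < \<rho>" "0 < s" "s < \<rho>" "0 < l"
    and "\<And>w w' x. w \<in> ball w0 s \<Longrightarrow> w' \<in> ball w0 s \<Longrightarrow> x \<in> cball x0 r \<Longrightarrow> g (x, w') = 0 \<Longrightarrow>
           \<exists>y\<in>cball x0 r. g (y, w) = 0 \<and> norm (x - y) \<le> l * norm (w' - w)"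
proof -
  interpret G: bounded_linear G using strict by (simp add: has_strict_derivative_def)
  have "linear (\<lambda>h. G (h, 0))"
    by (rule linearI) (simp_all flip: G.add G.scaleR)
  from linear_injective_isomorphism[OF this inj] obtain A where A: "linear A"
    and AG: "\<And>h. A (G (h, 0)) = h" and GA: "\<And>h. G (A h, 0) = h"
    by auto
  interpret A: bounded_linear A using A by (simp add: linear_conv_bounded_linear)
  obtain K where K: "K > 0" "\<And>x. norm (A x) \<le> norm x * K" using A.pos_bounded by blast
  obtain M where M: "M > 0" "\<And>x. norm (G x) \<le> norm x * M" using G.pos_bounded by blast
  \<comment> \<open>Chosen so that the contraction factor \<open>e * K\<close> is 1/2.\<close>
  define e where "e = 1 / (2 * K)"
  have e: "e > 0" "e * K = 1 / 2" using K(1) by (auto simp: e_def)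
  obtain R where R: "R > 0" and est: "\<And>x y. x \<in> ball (x0, w0) R \<Longrightarrow> y \<in> ball (x0, w0) R \<Longrightarrow>
      norm (g x - g y - G (x - y)) \<le> e * norm (x - y)"
    using has_strict_derivativeE[OF strict e(1)] by blast
  define r where "r = min R \<rho> / 2"
  \<comment> \<open>Lipschitz constant in \<open>w\<close> of \<open>A (g (x, w))\<close>:
    \<open>M\<close> bounds \<open>G\<close>, \<open>e\<close> the linearization error and
    \<open>K\<close> the map \<open>A\<close>.\<close>
  define N where "N = (M + e) * K"
  \<comment> \<open>\<open>s \<le> r\<close> keeps the product neighbourhood inside the ball of
    radius \<open>R\<close>; \<open>N * s \<le> r / 2\<close> limits the displacement of the
    centre.\<close>
  define s where "s = min r (r / (2 * N))"
  have r: "0 < r" "r < \<rho>" "2 * r \<le> R" using R \<open>\<rho> > 0\<close> by (auto simp: r_def)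
  have N: "N > 0" using M(1) e(1) K(1) by (simp add: N_def)
  have s: "0 < s" "s \<le> r" "N * s \<le> r / 2"
    using r N by (auto simp: s_def min_def field_simps)
  have inball: "(x, w) \<in> ball (x0, w0) R" if "x \<in> cball x0 r" "w \<in> ball w0 s" for x w
  proof -
    have "dist (x0, w0) (x, w) \<le> dist x0 x + dist w0 w"
      unfolding dist_Pair_Pair by (rule sqrt_sum_squares_le_sum) auto
    then show ?thesis using that r s by simp
  qed
  have param: "norm (A (g (x, w) - g (x, w'))) \<le> N * norm (w - w')"
    if "x \<in> cball x0 r" "w \<in> ball w0 s" "w' \<in> ball w0 s" for x w w'
  proof -
    have "norm (g (x, w) - g (x, w') - G (0, w - w')) \<le> e * norm (w - w')"
      using est[OF inball inball, of x w x w'] that by (simp add: norm_Pair)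
    moreover have "norm (G (0, w - w')) \<le> norm (w - w') * M"
      using M(2)[of "(0, w - w')"] by (simp add: norm_Pair)
    ultimately have "norm (g (x, w) - g (x, w')) \<le> (M + e) * norm (w - w')"
      using norm_triangle_sub[of "g (x, w) - g (x, w')" "G (0, w - w')"] by (simp add: algebra_simps)
    then have "norm (g (x, w) - g (x, w')) * K \<le> (M + e) * norm (w - w') * K"
      using K(1) by (intro mult_right_mono) auto
    then show ?thesis
      using K(2)[of "g (x, w) - g (x, w')"] by (simp add: N_def mult_ac)
  qed
  define T where "T w x = x - A (g (x, w))" for w x
  have contr: "norm (T w x - T w y) \<le> norm (x - y) / 2"
    if "x \<in> cball x0 r" "y \<in> cball x0 r" "w \<in> ball w0 s" for x y w
  proof -
    have "T w x - T w y = - A (g (x, w) - g (y, w) - G (x - y, 0))"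
      by (simp add: T_def A.diff AG)
    then have "norm (T w x - T w y) = norm (A (g (x, w) - g (y, w) - G (x - y, 0)))"
      by (metis norm_minus_cancel)
    also have "\<dots> \<le> norm (g (x, w) - g (y, w) - G (x - y, 0)) * K" by (rule K(2))
    also have "\<dots> \<le> e * norm (x - y) * K"
      using est[OF inball inball, of x w y w] that K(1)
      by (intro mult_right_mono) (auto simp: norm_Pair)
    also have "\<dots> = e * K * norm (x - y)" by simp
    finally show ?thesis by (simp add: e(2))
  qed
  have sol: "\<exists>y\<in>cball x0 r. g (y, w) = 0 \<and> norm (x - y) \<le> 2 * N * norm (w' - w)"
    if w: "w \<in> ball w0 s" and w': "w' \<in> ball w0 s" and x: "x \<in> cball x0 r" and gx: "g (x, w') = 0"
    for w w' x
  proof -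
    have "\<exists>!y. y \<in> cball x0 r \<and> T w y = y"
    proof (rule Banach_fix)
      \<comment> \<open>The centre moves by at most \<open>r / 2\<close>, and the contraction keeps
        the other images within \<open>r / 2\<close> of the image of the centre.\<close>
      show "T w ` cball x0 r \<subseteq> cball x0 r"
      proof clarify
        fix y assume y: "y \<in> cball x0 r"
        have "norm (T w x0 - x0) \<le> N * norm (w - w0)"
          using param[of x0 w w0] w r s zero by (simp add: T_def)
        also have "\<dots> \<le> N * s" using w N by (intro mult_left_mono) (auto simp: dist_norm norm_minus_commute)
        also have "\<dots> \<le> r / 2" by (rule s(3))
        finally have "norm (T w x0 - x0) \<le> r / 2" .
        moreover have "norm (T w y - T w x0) \<le> r / 2"
          using contr[of y x0 w] y w r by (simp add: dist_norm norm_minus_commute)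
        ultimately show "T w y \<in> cball x0 r"
          using norm_triangle_ineq[of "T w y - T w x0" "T w x0 - x0"]
          by (simp add: dist_norm norm_minus_commute)
      qed
      show "dist (T w y) (T w z) \<le> 1 / 2 * dist y z" if "y \<in> cball x0 r" "z \<in> cball x0 r" for y z
        using contr[OF that w] by (simp add: dist_norm)
    qed (use r in \<open>auto intro: compact_imp_complete\<close>)
    then obtain y where y: "y \<in> cball x0 r" "T w y = y" by blast
    then have "A (g (y, w)) = 0" by (simp add: T_def)
    then have "g (y, w) = 0" using GA[of "g (y, w)"] G.zero by (simp add: zero_prod_def)
    moreover have "norm (x - y) \<le> 2 * N * norm (w' - w)"
    proof -
      \<comment> \<open>As \<open>g (x, w') = 0\<close>, the displacement is
        \<open>A (g (x, w) - g (x, w'))\<close>. Absorbing the term \<open>norm (x - y) / 2\<close>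
        below doubles the constant \<open>N\<close>.\<close>
      have "norm (x - T w x) \<le> N * norm (w' - w)"
        using param[OF x w w'] gx by (simp add: T_def norm_minus_commute)
      moreover have "norm (T w x - y) \<le> norm (x - y) / 2"
        using contr[OF x y(1) w] y(2) by simp
      ultimately show ?thesis
        using norm_triangle_ineq[of "x - T w x" "T w x - y"] by simp
    qed
    ultimately show ?thesis using y(1) by blast
  qed
  show ?thesis
    by (rule that[of r s "2 * N"]) (use r s N sol in auto)
qed

section \<open>Necessity and sufficiency of the kernel inclusion\<close>

theorem theorem3p1:
  fixes f0 F :: "(real^'n::finite) \<times> (real^'d::finite) \<Rightarrow> real"
    and xbar :: "real^'n" and wbar :: "real^'d"
  assumes "twice_continuously_differentiable f0"
    and "twice_continuously_differentiable F"
    and "xbar \<in> stationary_points f0 F wbar"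
    and "F (xbar, wbar) < 0"
  shows "(locally_Lipschitz_like (stationary_points f0 F) wbar xbar \<longrightarrow>
            mat_ker (hess_xx f0 (xbar, wbar)) \<subseteq> mat_ker (hess_wx f0 (xbar, wbar)))
       \<and> (mat_ker (hess_xx f0 (xbar, wbar)) \<inter> mat_ker (hess_wx f0 (xbar, wbar)) = {0}
          \<and> mat_ker (hess_xx f0 (xbar, wbar)) \<subseteq> mat_ker (hess_wx f0 (xbar, wbar)) \<longrightarrow>
            locally_Lipschitz_like (stationary_points f0 F) wbar xbar)
       \<and> (mat_ker (hess_xx f0 (xbar, wbar)) \<inter> mat_ker (hess_wx f0 (xbar, wbar)) = {0} \<longrightarrow>
            (locally_Lipschitz_like (stationary_points f0 F) wbar xbar \<longleftrightarrow>
             mat_ker (hess_xx f0 (xbar, wbar)) \<subseteq> mat_ker (hess_wx f0 (xbar, wbar))))"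
proof -
  let ?S = "stationary_points f0 F" and ?H = "hess_xx f0 (xbar, wbar)" and ?W = "hess_wx f0 (xbar, wbar)"
  obtain G where strict: "has_strict_derivative (grad_x f0) G (xbar, wbar)"
    and G_inner: "\<And>h k v. G (h, k) \<bullet> v = h \<bullet> (?H *v v) + k \<bullet> (?W *v v)"
    using grad_x_strict_derivative[OF assms(1)] by blast
  interpret G: bounded_linear G using strict by (simp add: has_strict_derivative_def)
  have contF: "continuous_on UNIV F"
    using assms(2) unfolding twice_continuously_differentiable_def
    by (metis continuous_at_imp_continuous_on has_derivative_continuous)
  then have "open {z. F z < 0}" by (intro open_Collect_less continuous_on_const)
  then obtain R where R: "R > 0" "ball (xbar, wbar) R \<subseteq> {z. F z < 0}"
    using assms(4) unfolding open_contains_ball by blast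
  have S_iff: "x \<in> ?S w \<longleftrightarrow> grad_x f0 (x, w) = 0"
    if "norm (x - xbar) + norm (w - wbar) < R" for x w
  proof (rule stationary_points_iff_grad_x_eq_0[OF contF])
    have "norm (x - xbar, w - wbar) < R" using that norm_Pair_le le_less_trans by blast
    then have "(x, w) \<in> ball (xbar, wbar) R"
      unfolding mem_ball by (subst dist_commute) (simp add: dist_norm)
    then show "F (x, w) < 0" using R(2) by auto
  qed
  have grad0: "grad_x f0 (xbar, wbar) = 0" using S_iff[of xbar wbar] R(1) assms(3) by simp

  have a: "mat_ker ?H \<subseteq> mat_ker ?W" if lip: "locally_Lipschitz_like ?S wbar xbar"
  proof
    fix v assume "v \<in> mat_ker ?H"
    then have v: "?H *v v = 0" by (simp add: mat_ker_def)
    \<comment> \<open>Taking the vector that should vanish as the parameter direction turns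
      \<open>k \<bullet> (?W *v v)\<close> into \<open>k \<bullet> k\<close>.\<close>
    define k where "k = ?W *v v"
    from lip obtain l U V where l: "l > 0" and U: "xbar \<in> interior U" and V: "wbar \<in> interior V"
      and incl: "\<And>w w'. w \<in> V \<Longrightarrow> w' \<in> V \<Longrightarrow>
        ?S w' \<inter> U \<subseteq> {x + (l * norm (w' - w)) *\<^sub>R b | x b. x \<in> ?S w \<and> b \<in> cball 0 1}"
      unfolding locally_Lipschitz_like_def by blast
    obtain d where d: "d > 0" "ball wbar d \<subseteq> V" using V by (auto simp: mem_interior)
    \<comment> \<open>For the parameter step \<open>t *\<^sub>R k\<close>, the solution moves by at
      most \<open>l * t * norm k\<close>, so the total displacement is at most
      \<open>t * C\<close>.\<close>
    define C where "C = (l + 1) * norm k"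
    have C: "C \<ge> 0" "norm k \<le> C" using l by (auto simp: C_def algebra_simps)
    have bound: "k \<bullet> k \<le> e * (C * norm v)" if "e > 0" for e
    proof -
      obtain \<rho> where \<rho>: "\<rho> > 0" and est: "\<And>x y. x \<in> ball (xbar, wbar) \<rho> \<Longrightarrow> y \<in> ball (xbar, wbar) \<rho> \<Longrightarrow>
          norm (grad_x f0 x - grad_x f0 y - G (x - y)) \<le> e * norm (x - y)"
        using has_strict_derivativeE[OF strict \<open>e > 0\<close>] by blast
      define m where "m = min d (min R \<rho>)"
      \<comment> \<open>The added 1 keeps the denominator positive when
        \<open>k = 0\<close>.\<close>
      define t where "t = m / (C + 1)"
      have m: "m > 0" "m \<le> d" "m \<le> R" "m \<le> \<rho>" using d R \<rho> by (auto simp: m_def)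
      have t: "t > 0" "t * C < m" using m(1) C(1) by (auto simp: t_def field_simps)
      have "t * norm k < m" using mult_left_mono[OF C(2), of t] t by linarith
      then have "wbar + t *\<^sub>R k \<in> V" using d m(2) t(1) by (intro subsetD[OF d(2)]) (simp add: dist_norm)
      moreover have "wbar \<in> V" "xbar \<in> U" using U V interior_subset by blast+
      \<comment> \<open>The inclusion is read from \<open>wbar\<close> to the perturbed parameter:
        \<open>xbar\<close> itself has a nearby solution \<open>x\<close>.\<close>
      ultimately obtain x b where xb: "xbar = x + (l * norm (wbar - (wbar + t *\<^sub>R k))) *\<^sub>R b"
        and xS: "x \<in> ?S (wbar + t *\<^sub>R k)" and b: "norm b \<le> 1"
        using incl[of "wbar + t *\<^sub>R k" wbar] assms(3) by auto
      have "norm (x - xbar) = l * (t * norm k) * norm b"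
        unfolding xb using l t(1) by (simp add: abs_mult)
      also have "\<dots> \<le> l * (t * norm k)"
        using b l t(1) by (intro mult_left_le) auto
      finally have dx: "norm (x - xbar) + norm (t *\<^sub>R k) \<le> t * C"
        using t(1) by (simp add: C_def algebra_simps)
      have grad: "grad_x f0 (x, wbar + t *\<^sub>R k) = 0"
        using S_iff[of x "wbar + t *\<^sub>R k"] dx t m xS by simp
      have dist: "norm (x - xbar, t *\<^sub>R k) \<le> t * C"
        using norm_Pair_le[of "x - xbar" "t *\<^sub>R k"] dx by linarith
      have "(x, wbar + t *\<^sub>R k) \<in> ball (xbar, wbar) \<rho>"
        unfolding mem_ball using dist t m by (subst dist_commute) (simp add: dist_norm)
      from est[OF this, of "(xbar, wbar)"] grad grad0 \<rho>
      have "norm (G (x - xbar, t *\<^sub>R k)) \<le> e * norm (x - xbar, t *\<^sub>R k)" by simp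
      also have "\<dots> \<le> e * (t * C)" using dist \<open>e > 0\<close> by (intro mult_left_mono) auto
      finally have "norm (G (x - xbar, t *\<^sub>R k)) * norm v \<le> e * (t * C) * norm v"
        by (intro mult_right_mono) auto
      \<comment> \<open>The unknown displacement \<open>x - xbar\<close> drops out because
        \<open>?H *v v = 0\<close>.\<close>
      moreover have "t * (k \<bullet> k) = G (x - xbar, t *\<^sub>R k) \<bullet> v"
        unfolding G_inner v by (simp add: k_def)
      ultimately have "t * (k \<bullet> k) \<le> t * (e * (C * norm v))"
        using norm_cauchy_schwarz[of "G (x - xbar, t *\<^sub>R k)" v] by (simp add: mult_ac)
      then show ?thesis using t(1) by simp
    qed
    have "k \<bullet> k \<le> 0"
    proof (rule field_le_epsilon)
      fix e :: real assume "e > 0"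
      have D: "C * norm v \<ge> 0" using C(1) by simp
      then have "k \<bullet> k \<le> e / (C * norm v + 1) * (C * norm v)"
        using \<open>e > 0\<close> by (intro bound) (auto intro!: divide_pos_pos)
      also have "\<dots> \<le> e" using D \<open>e > 0\<close> by (simp add: field_simps)
      finally show "k \<bullet> k \<le> 0 + e" by simp
    qed
    then have "k = 0" by (metis inner_gt_zero_iff not_le)
    then show "v \<in> mat_ker ?W" by (simp add: mat_ker_def k_def)
  qed

  have b: "locally_Lipschitz_like ?S wbar xbar"
    if "mat_ker ?H \<inter> mat_ker ?W = {0}" "mat_ker ?H \<subseteq> mat_ker ?W"
  proof -
    have "mat_ker ?H = {0}" using that by blast
    then have "inj ((*v) ?H)" by (auto simp: mat_ker_def matrix_left_invertible_ker
          simp flip: matrix_left_invertible_injective)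
    then have surjH: "surj ((*v) ?H)" by (simp add: linear_injective_imp_surjective)
    \<comment> \<open>This map is the transpose of \<open>?H\<close>: a difference of two points
      with equal image is orthogonal to the range of \<open>?H\<close>, which is the whole
      space.\<close>
    have "inj (\<lambda>h. G (h, 0))"
    proof (rule injI)
      fix h h' assume "G (h, 0) = G (h', 0)"
      then have "(h - h') \<bullet> (?H *v v) = 0" for v
        using G_inner[of h 0 v] G_inner[of h' 0 v] by (simp add: inner_diff_left)
      then have "(h - h') \<bullet> (h - h') = 0" using surjH by (metis surjD)
      then show "h = h'" by simp
    qed
    \<comment> \<open>Radii below \<open>R / 2\<close> keep the sum of both distances below
      \<open>R\<close>, as \<open>S_iff\<close> requires.\<close>
    from Lipschitz_implicit_solutions[OF strict this grad0 half_gt_zero[OF R(1)]]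
    obtain r s l where rsl: "0 < r" "r < R / 2" "0 < s" "s < R / 2" "0 < l"
      and sol: "\<And>w w' x. w \<in> ball wbar s \<Longrightarrow> w' \<in> ball wbar s \<Longrightarrow> x \<in> cball xbar r \<Longrightarrow>
        grad_x f0 (x, w') = 0 \<Longrightarrow>
        \<exists>y\<in>cball xbar r. grad_x f0 (y, w) = 0 \<and> norm (x - y) \<le> l * norm (w' - w)"
      by blast
    have S_iff': "x \<in> ?S w \<longleftrightarrow> grad_x f0 (x, w) = 0" if "x \<in> cball xbar r" "w \<in> ball wbar s" for x w
      using that rsl by (intro S_iff) (simp add: dist_norm norm_minus_commute)
    have "\<exists>y c. x = y + (l * norm (w' - w)) *\<^sub>R c \<and> y \<in> ?S w \<and> c \<in> cball 0 1"
      if w: "w \<in> ball wbar s" "w' \<in> ball wbar s" and x: "x \<in> ?S w'" "x \<in> cball xbar r" for w w' x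
    proof -
      define q where "q = l * norm (w' - w)"
      obtain y where y: "y \<in> ?S w" "norm (x - y) \<le> q"
        using sol[OF w x(2)] x S_iff' w unfolding q_def by blast
      \<comment> \<open>If \<open>q = 0\<close>, then \<open>x = y\<close>, and \<open>c\<close> is
        0 because \<open>inverse 0 = 0\<close>.\<close>
      define c where "c = (x - y) /\<^sub>R q"
      have "x = y + q *\<^sub>R c" "norm c \<le> 1"
        using y(2) norm_ge_zero[of "x - y"] by (auto simp: c_def divide_simps)
      then show ?thesis using y(1) unfolding q_def by auto
    qed
    then show ?thesis
      unfolding locally_Lipschitz_like_def using rsl assms(3)
      by (intro conjI exI[of _ l] exI[of _ "cball xbar r"] exI[of _ "ball wbar s"] ballI subsetI) auto
  qed
  from a b show ?thesis by blast
qed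

end
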